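(* Let $(X,\star)$ be a spindle with a right unit (an element $u\in X$ with $y\star u=y$ for all $y\in X$), and consider three-term distributive homology with integer scalars $(a,b,d)$ such that $\gcd(a,b)=1$. Then for any $x\in X$ and $t\in X$, and every $n$, $$H_n(X,t)\cong H_n(X\star x,\ t\star x),$$ where $X\star x=\{y\star x: y\in X\}$.
   Context: A spindle $(X,\star)$ is a set with a binary operation that is right self-distributive, $(x\star y)\star z=(x\star z)\star(y\star z)$, and idempotent, $x\star x=x$. The right orbit $X\star x$ is closed under $\star$, hence itself a spindle. The three-term chain complex $C(X)$ for integer scalars $(a,b,d)$ uses the operations $x\vdash y:=x$, $\star$, and $x\dashv y:=y$: $C_n(X)=\mathbb ZX^{n+1}$ for $n\ge 0$ (zero for $n<0$) and $\partial=a\,\partial^{\vdash}+b\,\partial^{\star}+d\,\partial^{\dashv}$, where for a binary operation $*$: $\partial^*_n=\sum_{i=0}^n(-1)^id_i^*$ for $n\ge1$, $\partial_0=0$, $d_0^*(x_0,\dots,x_n)=(x_1,\dots,x_n)$, and $d_i^*(x_0,\dots,x_n)=(x_0*x_i,\dots,x_{i-1}*x_i,x_{i+1},\dots,x_n)$ for $i\ge1$. For $t\in X$, $C(\{t\})\subset C(X)$ is the subcomplex spanned by tuples $(t,\dots,t)$, $C(X,t):=C(X)/C(\{t\})$, and $H_n(X,t)$ is its homology. *)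

theory Defs
  imports "HOL-Algebra.Free_Abelian_Groups"
begin

locale spindle =
  fixes X :: "'a set" and star :: "'a \<Rightarrow> 'a \<Rightarrow> 'a"
  assumes star_closed: "\<lbrakk>x \<in> X; y \<in> X\<rbrakk> \<Longrightarrow> star x y \<in> X"
    and star_distrib: "\<lbrakk>x \<in> X; y \<in> X; z \<in> X\<rbrakk> \<Longrightarrow> star (star x y) z = star (star x z) (star y z)"
    and star_idem: "x \<in> X \<Longrightarrow> star x x = x"

definition right_unit :: "'a set \<Rightarrow> ('a \<Rightarrow> 'a \<Rightarrow> 'a) \<Rightarrow> 'a \<Rightarrow> bool" where
  "right_unit X star u \<longleftrightarrow> u \<in> X \<and> (\<forall>y\<in>X. star y u = y)"

definition right_orbit :: "'a set \<Rightarrow> ('a \<Rightarrow> 'a \<Rightarrow> 'a) \<Rightarrow> 'a \<Rightarrow> 'a set" where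
  "right_orbit X star x = {star y x | y. y \<in> X}"

(* The tuple (x_0, ..., x_n) is the list [x_0, ..., x_n].  The degree n is an integer; there are
   no tuples in negative degree (in particular the empty list is excluded in degree -1). *)
definition tuples :: "'a set \<Rightarrow> int \<Rightarrow> 'a list set" where
  "tuples X n = {xs. 0 \<le> n \<and> int (length xs) = n + 1 \<and> set xs \<subseteq> X}"

definition chains :: "'a set \<Rightarrow> int \<Rightarrow> ('a list \<Rightarrow>\<^sub>0 int) monoid" where
  "chains X n = free_Abelian_group (tuples X n)"

(* For i = 0 this drops the first entry, whatever the operation. *)
definition face :: "('a \<Rightarrow> 'a \<Rightarrow> 'a) \<Rightarrow> nat \<Rightarrow> 'a list \<Rightarrow> 'a list" where
  "face f i xs = map (\<lambda>y. f y (xs ! i)) (take i xs) @ drop (Suc i) xs"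

(* The boundary of a single operation, in all degrees at once: the degree of a generator is
   length xs - 1, and the boundary vanishes in degree 0. *)
definition one_term_boundary ::
    "('a \<Rightarrow> 'a \<Rightarrow> 'a) \<Rightarrow> ('a list \<Rightarrow>\<^sub>0 int) \<Rightarrow> ('a list \<Rightarrow>\<^sub>0 int)" where
  "one_term_boundary f = frag_extend (\<lambda>xs. if length xs \<le> 1 then 0
     else \<Sum>i<length xs. frag_cmul ((-1) ^ i) (frag_of (face f i xs)))"

definition boundary ::
    "('a \<Rightarrow> 'a \<Rightarrow> 'a) \<Rightarrow> int \<Rightarrow> int \<Rightarrow> int \<Rightarrow> ('a list \<Rightarrow>\<^sub>0 int) \<Rightarrow> ('a list \<Rightarrow>\<^sub>0 int)" where
  "boundary star a b d c =
     frag_cmul a (one_term_boundary (\<lambda>x y. x) c)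
   + frag_cmul b (one_term_boundary star c)
   + frag_cmul d (one_term_boundary (\<lambda>x y. y) c)"

definition rel_chains :: "'a set \<Rightarrow> 'a \<Rightarrow> int \<Rightarrow> ('a list \<Rightarrow>\<^sub>0 int) set monoid" where
  "rel_chains X t n = chains X n Mod carrier (chains {t} n)"

(* The differential induced on the quotient complex, from degree n to degree n - 1.  Since the
   boundary preserves the chains on {t}, all the cosets in this union coincide. *)
definition rel_boundary ::
    "('a \<Rightarrow> 'a \<Rightarrow> 'a) \<Rightarrow> int \<Rightarrow> int \<Rightarrow> int \<Rightarrow> 'a set \<Rightarrow> 'a \<Rightarrow> int
      \<Rightarrow> ('a list \<Rightarrow>\<^sub>0 int) set \<Rightarrow> ('a list \<Rightarrow>\<^sub>0 int) set" where
  "rel_boundary star a b d X t n K =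
     (\<Union>c\<in>K. carrier (chains {t} (n - 1)) #>\<^bsub>chains X (n - 1)\<^esub> boundary star a b d c)"

definition rel_cycles ::
    "('a \<Rightarrow> 'a \<Rightarrow> 'a) \<Rightarrow> int \<Rightarrow> int \<Rightarrow> int \<Rightarrow> 'a set \<Rightarrow> 'a \<Rightarrow> int \<Rightarrow> ('a list \<Rightarrow>\<^sub>0 int) set set" where
  "rel_cycles star a b d X t n =
     kernel (rel_chains X t n) (rel_chains X t (n - 1)) (rel_boundary star a b d X t n)"

definition rel_boundaries ::
    "('a \<Rightarrow> 'a \<Rightarrow> 'a) \<Rightarrow> int \<Rightarrow> int \<Rightarrow> int \<Rightarrow> 'a set \<Rightarrow> 'a \<Rightarrow> int \<Rightarrow> ('a list \<Rightarrow>\<^sub>0 int) set set" where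
  "rel_boundaries star a b d X t n =
     rel_boundary star a b d X t (n + 1) ` carrier (rel_chains X t (n + 1))"

definition rel_homology ::
    "('a \<Rightarrow> 'a \<Rightarrow> 'a) \<Rightarrow> int \<Rightarrow> int \<Rightarrow> int \<Rightarrow> 'a set \<Rightarrow> 'a \<Rightarrow> int
      \<Rightarrow> ('a list \<Rightarrow>\<^sub>0 int) set set monoid" where
  "rel_homology star a b d X t n =
     (rel_chains X t n)\<lparr>carrier := rel_cycles star a b d X t n\<rparr> Mod rel_boundaries star a b d X t n"

end

theory Submission
  imports Defs
begin

text \<open>
  Write \<open>\<partial>\<close> for the three-term boundary, \<open>h\<^sub>x\<close> for the map that appends the entry \<open>x\<close> to a tuple,
  \<open>r\<^sub>x\<close> for the map induced by the right translation \<open>y \<mapsto> y \<star> x\<close>, and \<open>c\<^sub>t\<close> for the map induced by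
  the constant function with value \<open>t\<close>. The last face of \<open>h\<^sub>x\<close> is a right multiplication by \<open>x\<close>,
  taken with respect to each of the three operations, so that in degree \<open>n\<close>
  \<open>\<partial> h\<^sub>x - h\<^sub>x \<partial> = (-1)\<^sup>n\<^sup>+\<^sup>1 (a + b r\<^sub>x + d c\<^sub>x)\<close>, apart from an additional multiple of \<open>c\<^sub>x\<close> when
  \<open>n = 0\<close> (lemma \<open>boundary_append_entry\<close>).

  The terms with \<open>c\<^sub>x\<close> disappear on the chains that are killed by the constant maps, the reduced
  chains. All the \<open>c\<^sub>t\<close> have the same kernel, namely the chains whose coefficients add up to \<open>0\<close>.
  As \<open>c\<^sub>t\<close> is a chain map and projects onto the chains on \<open>{t}\<close>, the reduced chains form a
  complement of the latter, and \<open>H\<^sub>n(X,t)\<close> is the homology of the reduced complex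
  (lemma \<open>reduced_boundaries_quotient\<close>). This removes the base point from the problem. It is also
  what makes a homotopy with \<open>x \<noteq> t\<close> usable: \<open>h\<^sub>x\<close> preserves reduced chains, although it does not
  descend to the quotient by the chains on \<open>{t}\<close>.

  On reduced homology the homotopy gives \<open>a + b r\<^sub>x = 0\<close> for every \<open>x\<close>, and for a right unit in the
  place of \<open>x\<close> it gives \<open>a + b = 0\<close>. Hence both \<open>a\<close> and \<open>b\<close> annihilate \<open>r\<^sub>x - 1\<close>, and since they
  are coprime, \<open>r\<^sub>x = 1\<close> (lemma \<open>translation_homologous_identity\<close>). The orbit \<open>X \<star> x\<close> is a spindle
  that contains \<open>x\<close> and has the right unit \<open>u \<star> x\<close>, so the same holds there. Thus \<open>r\<^sub>x\<close> from \<open>X\<close>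
  to \<open>X \<star> x\<close> and the inclusion of \<open>X \<star> x\<close> into \<open>X\<close> are mutually inverse on reduced homology.
\<close>

section \<open>Chains and linear maps\<close>

lemma in_chains_iff: "c \<in> carrier (chains X n) \<longleftrightarrow> Poly_Mapping.keys c \<subseteq> tuples X n"
  by (simp add: chains_def)

lemma zero_in_chains [simp]: "0 \<in> carrier (chains X n)"
  by (simp add: in_chains_iff)

lemma frag_of_in_chains [simp]: "frag_of xs \<in> carrier (chains X n) \<longleftrightarrow> xs \<in> tuples X n"
  by (simp add: in_chains_iff)

lemma add_in_chains:
  "\<lbrakk>c \<in> carrier (chains X n); e \<in> carrier (chains X n)\<rbrakk> \<Longrightarrow> c + e \<in> carrier (chains X n)"
  unfolding in_chains_iff using keys_add[of c e] by blast

lemma diff_in_chains: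
  "\<lbrakk>c \<in> carrier (chains X n); e \<in> carrier (chains X n)\<rbrakk> \<Longrightarrow> c - e \<in> carrier (chains X n)"
  unfolding in_chains_iff using keys_diff[of c e] by blast

lemma cmul_in_chains: "c \<in> carrier (chains X n) \<Longrightarrow> frag_cmul k c \<in> carrier (chains X n)"
  unfolding in_chains_iff using keys_cmul[of k c] by blast

lemma sum_in_chains:
  "(\<And>i. i \<in> I \<Longrightarrow> c i \<in> carrier (chains X n)) \<Longrightarrow> sum c I \<in> carrier (chains X n)"
  by (induction I rule: infinite_finite_induct) (auto intro: add_in_chains)

lemma chains_mono: "Y \<subseteq> X \<Longrightarrow> carrier (chains Y n) \<subseteq> carrier (chains X n)"
proof -
  assume "Y \<subseteq> X"
  then have "tuples Y n \<subseteq> tuples X n" by (auto simp: tuples_def)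
  then show ?thesis by (auto simp: in_chains_iff)
qed

lemma frag_extend_in_chains:
  assumes "c \<in> carrier (chains X n)"
    and "\<And>xs. xs \<in> tuples X n \<Longrightarrow> g xs \<in> carrier (chains Y m)"
  shows "frag_extend g c \<in> carrier (chains Y m)"
  using assms keys_frag_extend[of g c] unfolding in_chains_iff by fast

lemma chains_induct [consumes 1, case_names zero generator diff]:
  assumes "c \<in> carrier (chains X n)" and "P 0"
    and "\<And>xs. xs \<in> tuples X n \<Longrightarrow> P (frag_of xs)"
    and "\<And>c e. \<lbrakk>P c; P e\<rbrakk> \<Longrightarrow> P (c - e)"
  shows "P c"
  using assms(1)[unfolded in_chains_iff] assms(2-) by (rule frag_induction)

lemma frag_cmul_diff_distrib2: "frag_cmul k (c - e) = frag_cmul k c - frag_cmul k e"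
  by (simp add: poly_mapping_eqI lookup_minus right_diff_distrib)

definition induced :: "('a \<Rightarrow> 'b) \<Rightarrow> ('a list \<Rightarrow>\<^sub>0 int) \<Rightarrow> ('b list \<Rightarrow>\<^sub>0 int)" where
  "induced f = frag_extend (frag_of \<circ> map f)"

definition append_entry :: "'a \<Rightarrow> ('a list \<Rightarrow>\<^sub>0 int) \<Rightarrow> ('a list \<Rightarrow>\<^sub>0 int)" where
  "append_entry x = frag_extend (\<lambda>xs. frag_of (xs @ [x]))"

lemma induced_linear [simp]:
  "induced f 0 = 0"
  "induced f (frag_of xs) = frag_of (map f xs)"
  "induced f (c + e) = induced f c + induced f e"
  "induced f (c - e) = induced f c - induced f e"
  "induced f (frag_cmul k c) = frag_cmul k (induced f c)"
  by (simp_all add: induced_def frag_extend_add frag_extend_diff frag_extend_cmul)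

lemma append_entry_linear [simp]:
  "append_entry x 0 = 0"
  "append_entry x (frag_of xs) = frag_of (xs @ [x])"
  "append_entry x (c + e) = append_entry x c + append_entry x e"
  "append_entry x (c - e) = append_entry x c - append_entry x e"
  "append_entry x (frag_cmul k c) = frag_cmul k (append_entry x c)"
  by (simp_all add: append_entry_def frag_extend_add frag_extend_diff frag_extend_cmul)

lemma one_term_boundary_linear [simp]:
  "one_term_boundary f 0 = 0"
  "one_term_boundary f (c + e) = one_term_boundary f c + one_term_boundary f e"
  "one_term_boundary f (c - e) = one_term_boundary f c - one_term_boundary f e"
  "one_term_boundary f (frag_cmul k c) = frag_cmul k (one_term_boundary f c)"
  by (simp_all add: one_term_boundary_def frag_extend_add frag_extend_diff frag_extend_cmul)

lemma boundary_linear [simp]: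
  "boundary star a b d 0 = 0"
  "boundary star a b d (c + e) = boundary star a b d c + boundary star a b d e"
  "boundary star a b d (c - e) = boundary star a b d c - boundary star a b d e"
  "boundary star a b d (frag_cmul k c) = frag_cmul k (boundary star a b d c)"
  by (simp_all add: boundary_def frag_cmul_distrib2 frag_cmul_diff_distrib2 mult.commute)

lemma one_term_boundary_frag_of:
  "one_term_boundary f (frag_of xs) = (if length xs \<le> 1 then 0
     else \<Sum>i<length xs. frag_cmul ((-1) ^ i) (frag_of (face f i xs)))"
  by (simp add: one_term_boundary_def)

lemma induced_sum: "induced f (sum c I) = (\<Sum>i\<in>I. induced f (c i))"
  by (induction I rule: infinite_finite_induct) auto

lemma append_entry_sum: "append_entry x (sum c I) = (\<Sum>i\<in>I. append_entry x (c i))"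
  by (induction I rule: infinite_finite_induct) auto

lemma induced_in_chains:
  assumes "c \<in> carrier (chains X n)" "f ` X \<subseteq> Y"
  shows "induced f c \<in> carrier (chains Y n)"
  unfolding induced_def using assms(1)
  by (rule frag_extend_in_chains) (use assms(2) in \<open>auto simp: tuples_def\<close>)

lemma append_entry_in_chains:
  assumes "c \<in> carrier (chains X n)" "x \<in> X"
  shows "append_entry x c \<in> carrier (chains X (n + 1))"
  unfolding append_entry_def using assms(1)
  by (rule frag_extend_in_chains) (use assms(2) in \<open>auto simp: tuples_def\<close>)

lemma induced_induced: "induced f (induced g c) = induced (f \<circ> g) c"
  unfolding induced_def by (simp add: frag_extend_compose comp_assoc map_comp_map)

lemma induced_ident:
  assumes "c \<in> carrier (chains X n)" "\<And>y. y \<in> X \<Longrightarrow> f y = y"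
  shows "induced f c = c"
  using assms(1)
proof (induction rule: chains_induct)
  case (generator xs)
  then have "map f xs = xs"
    using assms(2) by (auto simp: tuples_def intro: map_idI)
  then show ?case by simp
qed auto

text \<open>
  This is why appending an entry preserves reduced chains.
\<close>

lemma induced_const_append_entry:
  "induced (\<lambda>_. t) (append_entry x c) = append_entry t (induced (\<lambda>_. t) c)"
  using subset_UNIV by (induction c rule: frag_induction) auto

section \<open>Faces\<close>

lemma face_in_tuples:
  assumes "\<And>x y. \<lbrakk>x \<in> X; y \<in> X\<rbrakk> \<Longrightarrow> f x y \<in> X"
    and "xs \<in> tuples X n" "1 < length xs" "i < length xs"
  shows "face f i xs \<in> tuples X (n - 1)"
proof -
  have "set (face f i xs) \<subseteq> X"
    using assms set_take_subset[of i xs] set_drop_subset[of "Suc i" xs]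
    by (auto simp: face_def tuples_def subset_iff)
  moreover have "length (face f i xs) = length xs - 1"
    using assms(4) by (simp add: face_def)
  ultimately show ?thesis
    using assms(2,3) by (auto simp: tuples_def)
qed

text \<open>
  Faces are natural for homomorphisms; this makes the induced maps chain maps.
\<close>

lemma face_map:
  assumes "i < length xs" "\<And>y z. \<lbrakk>y \<in> set xs; z \<in> set xs\<rbrakk> \<Longrightarrow> g (f y z) = f (g y) (g z)"
  shows "face f i (map g xs) = map g (face f i xs)"
  using assms by (auto simp: face_def take_map drop_map dest: in_set_takeD)

lemma face_snoc: "i < length xs \<Longrightarrow> face f i (xs @ [x]) = face f i xs @ [x]"
  by (simp add: face_def nth_append)

lemma face_snoc_last: "face f (length xs) (xs @ [x]) = map (\<lambda>y. f y x) xs"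
  by (simp add: face_def)

lemma one_term_boundary_in_chains:
  assumes "\<And>x y. \<lbrakk>x \<in> X; y \<in> X\<rbrakk> \<Longrightarrow> f x y \<in> X" "c \<in> carrier (chains X n)"
  shows "one_term_boundary f c \<in> carrier (chains X (n - 1))"
  using assms(2)
proof (induction rule: chains_induct)
  case (generator xs)
  then show ?case
    by (auto simp: one_term_boundary_frag_of intro!: sum_in_chains cmul_in_chains
        face_in_tuples assms(1))
qed (auto intro: diff_in_chains)

lemma induced_one_term_boundary:
  assumes "c \<in> carrier (chains X n)"
    and "\<And>y z. \<lbrakk>y \<in> X; z \<in> X\<rbrakk> \<Longrightarrow> g (f y z) = f (g y) (g z)"
  shows "one_term_boundary f (induced g c) = induced g (one_term_boundary f c)"
  using assms(1)
proof (induction rule: chains_induct)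
  case (generator xs)
  then have "face f i (map g xs) = map g (face f i xs)" if "i < length xs" for i
    using that assms(2) by (intro face_map) (auto simp: tuples_def)
  then show ?case
    by (simp add: one_term_boundary_frag_of induced_sum)
qed auto

lemma one_term_boundary_degree_0:
  assumes "c \<in> carrier (chains X 0)"
  shows "one_term_boundary f c = 0"
  using assms
  by (induction rule: chains_induct) (auto simp: one_term_boundary_frag_of tuples_def)

text \<open>
  The first faces of \<open>xs @ [x]\<close> are those of \<open>xs\<close> with \<open>x\<close> appended, and the last one multiplies
  every entry by \<open>x\<close>. Degree \<open>0\<close> is exceptional because the boundary of a single entry is defined
  to be \<open>0\<close>: then the face \<open>[x]\<close> of \<open>[y, x]\<close> is not accounted for by the first term.
\<close>

lemma one_term_boundary_append_entry:
  assumes "c \<in> carrier (chains X n)"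
  shows "one_term_boundary f (append_entry x c)
    = append_entry x (one_term_boundary f c)
      + frag_cmul ((-1) ^ nat (n + 1)) (induced (\<lambda>y. f y x) c)
      + (if n = 0 then induced (\<lambda>_. x) c else 0)"
  using assms
proof (induction rule: chains_induct)
  case (generator xs)
  then have len: "int (length xs) = n + 1" "0 \<le> n"
    by (auto simp: tuples_def)
  then have n: "nat (n + 1) = length xs" "nat (1 + n) = length xs" and ne: "length xs \<noteq> 0"
    by auto
  have "one_term_boundary f (frag_of (xs @ [x]))
      = (\<Sum>i<length xs. frag_cmul ((-1) ^ i) (frag_of (face f i xs @ [x])))
        + frag_cmul ((-1) ^ length xs) (frag_of (map (\<lambda>y. f y x) xs))"
    using ne by (simp add: one_term_boundary_frag_of face_snoc face_snoc_last)
  also have "(\<Sum>i<length xs. frag_cmul ((-1) ^ i) (frag_of (face f i xs @ [x])))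
      = append_entry x (one_term_boundary f (frag_of xs))
        + (if n = 0 then induced (\<lambda>_. x) (frag_of xs) else 0)"
  proof (cases "n = 0")
    case True
    then obtain y where "xs = [y]"
      using len by (auto simp: length_Suc_conv)
    with True show ?thesis
      by (simp add: one_term_boundary_frag_of face_def)
  next
    case False
    then have "\<not> length xs \<le> 1" using len by linarith
    with False show ?thesis
      by (simp add: one_term_boundary_frag_of append_entry_sum)
  qed
  finally show ?case
    by (simp only: append_entry_linear induced_linear n ac_simps)
qed (auto simp: frag_cmul_diff_distrib2)

section \<open>The three-term complex\<close>

lemma boundary_degree_0: "c \<in> carrier (chains X 0) \<Longrightarrow> boundary star a b d c = 0"
  by (simp add: boundary_def one_term_boundary_degree_0)

lemma induced_boundary:
  assumes "c \<in> carrier (chains X n)"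
    and "\<And>y z. \<lbrakk>y \<in> X; z \<in> X\<rbrakk> \<Longrightarrow> g (star y z) = star (g y) (g z)"
  shows "boundary star a b d (induced g c) = induced g (boundary star a b d c)"
  using assms by (simp add: boundary_def induced_one_term_boundary)

lemma boundary_append_entry:
  assumes "c \<in> carrier (chains X n)"
  shows "boundary star a b d (append_entry x c)
    = append_entry x (boundary star a b d c)
      + frag_cmul ((-1) ^ nat (n + 1))
          (frag_cmul a c + frag_cmul b (induced (\<lambda>y. star y x) c) + frag_cmul d (induced (\<lambda>_. x) c))
      + (if n = 0 then frag_cmul (a + b + d) (induced (\<lambda>_. x) c) else 0)"
  using assms
  by (simp add: boundary_def one_term_boundary_append_entry induced_ident[OF assms, of "\<lambda>y. y"]
      frag_cmul_distrib frag_cmul_distrib2 mult.commute)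

lemma (in spindle) boundary_in_chains:
  assumes "c \<in> carrier (chains X n)"
  shows "boundary star a b d c \<in> carrier (chains X (n - 1))"
  unfolding boundary_def
  by (intro add_in_chains cmul_in_chains one_term_boundary_in_chains assms star_closed)

text \<open>
  Instead of the identities between two faces, the proof uses the homotopy formula: each generator
  of positive degree is of the form \<open>ys @ [x]\<close>. Applying \<open>boundary_append_entry\<close> twice, to \<open>ys\<close> and
  to its boundary, yields the same three terms with opposite signs, since the degrees differ by one,
  and the boundary of the boundary of \<open>ys\<close> is \<open>0\<close> by induction.
\<close>

lemma (in spindle) boundary_boundary:
  assumes "c \<in> carrier (chains X n)"
  shows "boundary star a b d (boundary star a b d c) = 0"
proof -
  let ?D = "boundary star a b d"
  have "?D (?D c) = 0" if "c \<in> carrier (chains X (int k))" for c k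
    using that
  proof (induction k arbitrary: c)
    case 0
    then show ?case by (simp add: boundary_degree_0)
  next
    case (Suc k)
    from Suc.prems show ?case
    proof (induction rule: chains_induct)
      case (generator xs)
      then obtain ys x where xs: "xs = ys @ [x]" and x: "x \<in> X" and ys: "ys \<in> tuples X (int k)"
        by (cases xs rule: rev_cases) (auto simp: tuples_def)
      let ?y = "frag_of ys"
      let ?r = "induced (\<lambda>y. star y x)" and ?c = "induced (\<lambda>_. x)"
      have y: "?y \<in> carrier (chains X (int k))" using ys by simp
      have y': "?D ?y \<in> carrier (chains X (int k - 1))"
        using y by (rule boundary_in_chains)
      have r: "?D (?r ?y) = ?r (?D ?y)"
        using y by (rule induced_boundary) (use x star_distrib in auto)
      have cst: "?D (?c ?y) = ?c (?D ?y)"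
        using y by (rule induced_boundary) (use x star_idem in auto)
      have start: "?D (frag_of xs) = append_entry x (?D ?y)
          + frag_cmul ((-1) ^ nat (int k + 1))
             (frag_cmul a ?y + frag_cmul b (?r ?y) + frag_cmul d (?c ?y))
          + (if int k = 0 then frag_cmul (a + b + d) (?c ?y) else 0)"
        using boundary_append_entry[OF y, of star a b d x] by (simp add: xs)
      show ?case
      proof (cases "k = 0")
        case True
        have "frag_of xs \<in> carrier (chains X 1)"
          using generator True by simp
        then have "?D (frag_of xs) \<in> carrier (chains X 0)"
          using boundary_in_chains[of "frag_of xs" 1 a b d] by simp
        then show ?thesis by (rule boundary_degree_0)
      next
        case False
        \<comment> \<open>The exceptional term of the homotopy formula for the boundary of \<open>ys\<close>, which has
          degree \<open>0\<close> here: its coefficients add up to \<open>0\<close>.\<close>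
        have low: "?c (?D ?y) = 0" if k1: "k = 1"
        proof -
          obtain p q where "ys = [p, q]"
            using ys k1 by (auto simp: tuples_def length_Suc_conv numeral_2_eq_2)
          then show ?thesis
            by (simp add: boundary_def one_term_boundary_frag_of face_def numeral_2_eq_2)
        qed
        have sgn: "(-1::int) ^ nat (int k - 1 + 1) = - ((-1) ^ nat (int k + 1))"
          by (simp add: nat_add_distrib)
        have "?D (append_entry x (?D ?y)) = append_entry x (?D (?D ?y))
          + frag_cmul ((-1) ^ nat (int k - 1 + 1))
             (frag_cmul a (?D ?y) + frag_cmul b (?r (?D ?y)) + frag_cmul d (?c (?D ?y)))"
          using boundary_append_entry[OF y', of star a b d x] low by auto
        then have "?D (append_entry x (?D ?y)) = - frag_cmul ((-1) ^ nat (int k + 1))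
             (frag_cmul a (?D ?y) + frag_cmul b (?r (?D ?y)) + frag_cmul d (?c (?D ?y)))"
          unfolding sgn using Suc.IH[OF y] by simp
        then show ?thesis
          using False unfolding start
            by (simp add: r cst del: induced_linear(2) flip: frag_cmul_distrib)
      qed
    qed auto
  qed
  \<comment> \<open>In negative degrees the only chain is \<open>0\<close>.\<close>
  moreover have "c \<in> carrier (chains X (int (nat n)))"
    using assms by (cases "n \<ge> 0") (auto simp: in_chains_iff tuples_def)
  ultimately show ?thesis by blast
qed


section \<open>Reduced chains\<close>

text \<open>
  Equivalently, the coefficients add up to \<open>0\<close>. The description by constant maps shows at once that
  chain maps and appended entries preserve reduced chains.
\<close>

definition reduced_chains :: "'a set \<Rightarrow> int \<Rightarrow> ('a list \<Rightarrow>\<^sub>0 int) set" where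
  "reduced_chains X n = {c \<in> carrier (chains X n). \<forall>t::'a. induced (\<lambda>_. t) c = 0}"

definition reduced_cycles ::
    "('a \<Rightarrow> 'a \<Rightarrow> 'a) \<Rightarrow> int \<Rightarrow> int \<Rightarrow> int \<Rightarrow> 'a set \<Rightarrow> int \<Rightarrow> ('a list \<Rightarrow>\<^sub>0 int) set" where
  "reduced_cycles star a b d X n = {c \<in> reduced_chains X n. boundary star a b d c = 0}"

definition reduced_boundaries ::
    "('a \<Rightarrow> 'a \<Rightarrow> 'a) \<Rightarrow> int \<Rightarrow> int \<Rightarrow> int \<Rightarrow> 'a set \<Rightarrow> int \<Rightarrow> ('a list \<Rightarrow>\<^sub>0 int) set" where
  "reduced_boundaries star a b d X n = boundary star a b d ` reduced_chains X (n + 1)"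

definition reduced_cycle_group ::
    "('a \<Rightarrow> 'a \<Rightarrow> 'a) \<Rightarrow> int \<Rightarrow> int \<Rightarrow> int \<Rightarrow> 'a set \<Rightarrow> int \<Rightarrow> ('a list \<Rightarrow>\<^sub>0 int) monoid" where
  "reduced_cycle_group star a b d X n = (chains X n)\<lparr>carrier := reduced_cycles star a b d X n\<rparr>"

text \<open>
  A constant map factors through any other constant map, so a single value \<open>t\<close> suffices.
\<close>

lemma reduced_chains_iff:
  fixes t :: 'a and c :: "'a list \<Rightarrow>\<^sub>0 int"
  shows "c \<in> reduced_chains X n \<longleftrightarrow> c \<in> carrier (chains X n) \<and> induced (\<lambda>_. t) c = 0"
proof -
  have "induced (\<lambda>_. s) c = 0" if "induced (\<lambda>_. t) c = 0" for s :: 'a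
  proof -
    have "induced (\<lambda>_. s) c = induced (\<lambda>_. s) (induced (\<lambda>_. t) c)"
      by (simp add: induced_induced comp_def)
    then show ?thesis using that by simp
  qed
  then show ?thesis by (auto simp: reduced_chains_def)
qed

lemma reduced_chains_diff:
  "\<lbrakk>c \<in> reduced_chains X n; e \<in> reduced_chains X n\<rbrakk> \<Longrightarrow> c - e \<in> reduced_chains X n"
  by (simp add: reduced_chains_def diff_in_chains)

lemma reduced_chains_add:
  "\<lbrakk>c \<in> reduced_chains X n; e \<in> reduced_chains X n\<rbrakk> \<Longrightarrow> c + e \<in> reduced_chains X n"
  by (simp add: reduced_chains_def add_in_chains)

lemma reduced_chains_cmul:
  "c \<in> reduced_chains X n \<Longrightarrow> frag_cmul k c \<in> reduced_chains X n"
  by (simp add: reduced_chains_def cmul_in_chains)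

lemma induced_reduced_chains:
  fixes g :: "'a \<Rightarrow> 'a"
  assumes "c \<in> reduced_chains X n" "g ` X \<subseteq> Y"
  shows "induced g c \<in> reduced_chains Y n"
  using assms induced_in_chains[of c X n g Y]
  by (auto simp: reduced_chains_def induced_induced comp_def)

lemma append_entry_reduced_chains:
  "\<lbrakk>c \<in> reduced_chains X n; x \<in> X\<rbrakk> \<Longrightarrow> append_entry x c \<in> reduced_chains X (n + 1)"
  by (simp add: reduced_chains_def append_entry_in_chains induced_const_append_entry)

lemma reduced_boundaries_mono:
  "Y \<subseteq> X \<Longrightarrow> reduced_boundaries star a b d Y n \<subseteq> reduced_boundaries star a b d X n"
  using chains_mono[of Y X "n + 1"] by (auto simp: reduced_boundaries_def reduced_chains_def)

lemma reduced_boundaries_diff: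
  assumes "c \<in> reduced_boundaries star a b d X n" "e \<in> reduced_boundaries star a b d X n"
  shows "c - e \<in> reduced_boundaries star a b d X n"
proof -
  obtain c' e' where "c' \<in> reduced_chains X (n + 1)" "e' \<in> reduced_chains X (n + 1)"
    and "c = boundary star a b d c'" "e = boundary star a b d e'"
    using assms by (auto simp: reduced_boundaries_def)
  then show ?thesis
    unfolding reduced_boundaries_def
    by (intro image_eqI[of _ _ "c' - e'"]) (auto intro: reduced_chains_diff)
qed

lemma reduced_boundaries_cmul:
  assumes "c \<in> reduced_boundaries star a b d X n"
  shows "frag_cmul k c \<in> reduced_boundaries star a b d X n"
proof -
  obtain c' where "c' \<in> reduced_chains X (n + 1)" and "c = boundary star a b d c'"
    using assms by (auto simp: reduced_boundaries_def)
  then show ?thesis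
    unfolding reduced_boundaries_def
    by (intro image_eqI[of _ _ "frag_cmul k c'"]) (auto intro: reduced_chains_cmul)
qed

lemma reduced_boundaries_add:
  assumes "c \<in> reduced_boundaries star a b d X n" "e \<in> reduced_boundaries star a b d X n"
  shows "c + e \<in> reduced_boundaries star a b d X n"
  using reduced_boundaries_diff[OF assms(1) reduced_boundaries_cmul[OF assms(2), of "-1"]] by simp

lemma boundary_append_entry_reduced:
  assumes "c \<in> reduced_chains X n"
  shows "boundary star a b d (append_entry x c)
    = append_entry x (boundary star a b d c)
      + frag_cmul ((-1) ^ nat (n + 1)) (frag_cmul a c + frag_cmul b (induced (\<lambda>y. star y x) c))"
  using assms boundary_append_entry[of c X n star a b d x] by (simp add: reduced_chains_def)

text \<open>
  On a reduced cycle the homotopy formula exhibits this combination, up to sign, as the boundary of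
  \<open>append_entry x c\<close>.
\<close>

lemma translation_combination_in_reduced_boundaries:
  assumes "c \<in> reduced_cycles star a b d X n" "x \<in> X"
  shows "frag_cmul a c + frag_cmul b (induced (\<lambda>y. star y x) c) \<in> reduced_boundaries star a b d X n"
proof -
  let ?s = "(-1::int) ^ nat (n + 1)"
  have c: "c \<in> reduced_chains X n" "boundary star a b d c = 0"
    using assms(1) by (auto simp: reduced_cycles_def)
  have "boundary star a b d (append_entry x c) \<in> reduced_boundaries star a b d X n"
    using append_entry_reduced_chains[OF c(1) assms(2)] by (simp add: reduced_boundaries_def)
  then have "frag_cmul ?s (boundary star a b d (append_entry x c)) \<in> reduced_boundaries star a b d X n"
    by (rule reduced_boundaries_cmul)
  moreover have "?s * ?s = 1"
    by (simp flip: power_mult_distrib)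
  ultimately show ?thesis
    by (simp add: boundary_append_entry_reduced[OF c(1)] c(2) del: frag_cmul_distrib2)
qed

lemma (in spindle) induced_translation_reduced_cycles:
  assumes "c \<in> reduced_cycles star a b d X n" "x \<in> X" "(\<lambda>y. star y x) ` X \<subseteq> Y"
  shows "induced (\<lambda>y. star y x) c \<in> reduced_cycles star a b d Y n"
proof -
  have c: "c \<in> reduced_chains X n" "boundary star a b d c = 0"
    using assms(1) by (auto simp: reduced_cycles_def)
  have "boundary star a b d (induced (\<lambda>y. star y x) c) = induced (\<lambda>y. star y x) (boundary star a b d c)"
    using c(1) by (intro induced_boundary[of c X n])
      (auto simp: reduced_chains_def star_distrib assms(2))
  then show ?thesis
    using induced_reduced_chains[OF c(1) assms(3)] c(2) by (simp add: reduced_cycles_def)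
qed

text \<open>
  Modulo reduced boundaries \<open>a c + b r = 0\<close> with \<open>r\<close> the translate of \<open>c\<close>, while the right unit,
  whose translation is the identity, gives \<open>a c + b c = 0\<close> and \<open>a r + b r = 0\<close>. Differences show that
  \<open>a\<close> and \<open>b\<close> both annihilate \<open>r - c\<close>, and a Bezout relation concludes.
\<close>

lemma (in spindle) translation_homologous_identity:
  assumes unit: "right_unit X star u" and coprime: "gcd a b = 1" and x: "x \<in> X"
    and c: "c \<in> reduced_cycles star a b d X n"
  shows "induced (\<lambda>y. star y x) c - c \<in> reduced_boundaries star a b d X n"
proof -
  let ?B = "reduced_boundaries star a b d X n"
  define r where "r = induced (\<lambda>y. star y x) c"
  have r: "r \<in> reduced_cycles star a b d X n"
    unfolding r_def using c x by (rule induced_translation_reduced_cycles) (use x star_closed in auto)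
  have unit_comb: "frag_cmul a e + frag_cmul b e \<in> ?B" if e: "e \<in> reduced_cycles star a b d X n" for e
  proof -
    have "induced (\<lambda>y. star y u) e = e"
      using e unit by (intro induced_ident[of e X n])
        (auto simp: reduced_cycles_def reduced_chains_def right_unit_def)
    moreover have "u \<in> X" using unit by (simp add: right_unit_def)
    ultimately show ?thesis
      using translation_combination_in_reduced_boundaries[OF e, of u] by simp
  qed
  have x_comb: "frag_cmul a c + frag_cmul b r \<in> ?B"
    unfolding r_def using c x by (rule translation_combination_in_reduced_boundaries)
  have "frag_cmul a (r - c) \<in> ?B"
    using reduced_boundaries_diff[OF unit_comb[OF r] x_comb]
    by (simp add: frag_cmul_diff_distrib2)
  moreover have "frag_cmul b (r - c) \<in> ?B"
    using reduced_boundaries_diff[OF x_comb unit_comb[OF c]]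
    by (simp add: frag_cmul_diff_distrib2)
  moreover obtain p q where "p * a + q * b = 1"
    using bezout_int[of a b] coprime by auto
  then have "frag_cmul p (frag_cmul a (r - c)) + frag_cmul q (frag_cmul b (r - c)) = r - c"
    by (simp flip: frag_cmul_distrib)
  ultimately show ?thesis
    unfolding r_def[symmetric] by (metis reduced_boundaries_add reduced_boundaries_cmul)
qed

lemma reduced_cycle_group_simps [simp]:
  "carrier (reduced_cycle_group star a b d X n) = reduced_cycles star a b d X n"
  "c \<otimes>\<^bsub>reduced_cycle_group star a b d X n\<^esub> e = c + e"
  "\<one>\<^bsub>reduced_cycle_group star a b d X n\<^esub> = 0"
  by (simp_all add: reduced_cycle_group_def chains_def)

lemma comm_group_reduced_cycle_group: "comm_group (reduced_cycle_group star a b d X n)"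
proof (rule comm_groupI)
  fix c assume "c \<in> carrier (reduced_cycle_group star a b d X n)"
  then show "\<exists>e\<in>carrier (reduced_cycle_group star a b d X n).
      e \<otimes>\<^bsub>reduced_cycle_group star a b d X n\<^esub> c = \<one>\<^bsub>reduced_cycle_group star a b d X n\<^esub>"
    using reduced_chains_cmul[of c X n "-1"] boundary_linear(4)[of star a b d "-1" c]
    by (intro bexI[of _ "- c"]) (auto simp: reduced_cycles_def)
qed (auto simp: reduced_cycles_def reduced_chains_add reduced_chains_def add_in_chains)

section \<open>Relative homology through reduced cycles\<close>

lemma (in group) r_coset_eq_iff:
  assumes "subgroup H G" "y \<in> carrier G" "z \<in> carrier G"
  shows "H #> y = H #> z \<longleftrightarrow> y \<otimes> inv z \<in> H"
  using assms repr_independence[of y H z] rcos_self[of y H]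
    subgroup.rcos_module[OF assms(1) is_group assms(3,2)] by auto

lemma chains_simps [simp]:
  "c \<otimes>\<^bsub>chains X n\<^esub> e = c + e"
  "\<one>\<^bsub>chains X n\<^esub> = 0"
  by (simp_all add: chains_def)

lemma comm_group_chains: "comm_group (chains X n)"
  by (simp add: chains_def abelian_free_Abelian_group)

lemma inv_chains: "c \<in> carrier (chains X n) \<Longrightarrow> inv\<^bsub>chains X n\<^esub> c = - c"
  by (simp add: chains_def)

lemma subgroup_subset_chains:
  assumes "Y \<subseteq> X"
  shows "subgroup (carrier (chains Y n)) (chains X n)"
proof (rule group.subgroupI)
  show "group (chains X n)"
    using comm_group_chains comm_group.axioms(2) by blast
  show "inv\<^bsub>chains X n\<^esub> c \<in> carrier (chains Y n)" if "c \<in> carrier (chains Y n)" for c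
    using that chains_mono[OF assms, of n] cmul_in_chains[OF that, of "-1"]
    by (simp add: inv_chains subset_iff)
qed (use chains_mono[OF assms, of n] in \<open>auto simp: add_in_chains intro: zero_in_chains\<close>)

lemma normal_subset_chains: "Y \<subseteq> X \<Longrightarrow> carrier (chains Y n) \<lhd> chains X n"
  by (simp add: comm_group.normal_iff_subgroup[OF comm_group_chains] subgroup_subset_chains)

lemma carrier_rel_chains:
  "carrier (rel_chains X t n)
    = (\<lambda>c. carrier (chains {t} n) #>\<^bsub>chains X n\<^esub> c) ` carrier (chains X n)"
  by (simp add: rel_chains_def carrier_FactGroup)

lemma comm_group_rel_chains: "t \<in> X \<Longrightarrow> comm_group (rel_chains X t n)"
  unfolding rel_chains_def
  by (simp add: comm_group.abelian_FactGroup[OF comm_group_chains] subgroup_subset_chains)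

lemma rel_chain_class_eq_iff:
  assumes "t \<in> X" "c \<in> carrier (chains X n)" "e \<in> carrier (chains X n)"
  shows "carrier (chains {t} n) #>\<^bsub>chains X n\<^esub> c = carrier (chains {t} n) #>\<^bsub>chains X n\<^esub> e
    \<longleftrightarrow> c - e \<in> carrier (chains {t} n)"
  using group.r_coset_eq_iff[OF comm_group.axioms(2)[OF comm_group_chains]
      subgroup_subset_chains[of "{t}" X n] assms(2,3)] assms
  by (simp add: inv_chains)

lemma rel_chain_class_mult:
  assumes "t \<in> X" "c \<in> carrier (chains X n)" "e \<in> carrier (chains X n)"
  shows "(carrier (chains {t} n) #>\<^bsub>chains X n\<^esub> c) \<otimes>\<^bsub>rel_chains X t n\<^esub>
      (carrier (chains {t} n) #>\<^bsub>chains X n\<^esub> e) = carrier (chains {t} n) #>\<^bsub>chains X n\<^esub> (c + e)"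
  using normal.rcos_sum[OF normal_subset_chains[of "{t}" X n] assms(2,3)] assms(1)
  by (simp add: rel_chains_def)

lemma one_rel_chains:
  assumes "t \<in> X"
  shows "\<one>\<^bsub>rel_chains X t n\<^esub> = carrier (chains {t} n) #>\<^bsub>chains X n\<^esub> 0"
  by (auto simp: rel_chains_def r_coset_def)

lemma (in spindle) singleton_spindle: "t \<in> X \<Longrightarrow> spindle {t} star"
  by unfold_locales (auto simp: star_idem)

text \<open>
  The union in the definition of the relative boundary ranges over equal cosets, because the
  boundary maps chains on \<open>{t}\<close> to chains on \<open>{t}\<close>.
\<close>

lemma (in spindle) rel_boundary_class:
  assumes t: "t \<in> X" and c: "c \<in> carrier (chains X n)"
  shows "rel_boundary star a b d X t n (carrier (chains {t} n) #>\<^bsub>chains X n\<^esub> c)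
    = carrier (chains {t} (n - 1)) #>\<^bsub>chains X (n - 1)\<^esub> boundary star a b d c"
proof -
  let ?N = "carrier (chains {t} n)" and ?D = "boundary star a b d"
  have "carrier (chains {t} (n - 1)) #>\<^bsub>chains X (n - 1)\<^esub> ?D (s + c)
      = carrier (chains {t} (n - 1)) #>\<^bsub>chains X (n - 1)\<^esub> ?D c" if s: "s \<in> ?N" for s
  proof -
    have "s \<in> carrier (chains X n)"
      using s t chains_mono[of "{t}" X n] by auto
    moreover have "?D s \<in> carrier (chains {t} (n - 1))"
      using spindle.boundary_in_chains[OF singleton_spindle[OF t] s] .
    ultimately show ?thesis
      using t c by (subst rel_chain_class_eq_iff)
        (auto intro: add_in_chains boundary_in_chains simp flip: boundary_linear)
  qed
  moreover have "?N \<noteq> {}"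
    using zero_in_chains by blast
  ultimately show ?thesis
    by (auto simp: rel_boundary_def r_coset_def[of "chains X n"])
qed

lemma (in spindle) rel_boundary_group_hom:
  assumes t: "t \<in> X"
  shows "group_hom (rel_chains X t n) (rel_chains X t (n - 1)) (rel_boundary star a b d X t n)"
proof -
  have "rel_boundary star a b d X t n \<in> hom (rel_chains X t n) (rel_chains X t (n - 1))"
    by (rule homI) (auto simp: carrier_rel_chains rel_boundary_class t rel_chain_class_mult
        boundary_in_chains add_in_chains)
  then show ?thesis
    using comm_group_rel_chains[OF t] comm_group.axioms(2)
    unfolding group_hom_def group_hom_axioms_def by blast
qed

lemma (in spindle) rel_chain_class_in_rel_cycles_iff:
  assumes t: "t \<in> X" and c: "c \<in> carrier (chains X n)"
  shows "carrier (chains {t} n) #>\<^bsub>chains X n\<^esub> c \<in> rel_cycles star a b d X t n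
    \<longleftrightarrow> boundary star a b d c \<in> carrier (chains {t} (n - 1))"
  using c rel_chain_class_eq_iff[OF t boundary_in_chains[OF c, of a b d] zero_in_chains]
  by (auto simp: rel_cycles_def kernel_def carrier_rel_chains rel_boundary_class t one_rel_chains)

text \<open>
  The constant map with value \<open>t\<close> is a projection onto the chains on \<open>{t}\<close> whose kernel consists of
  the reduced chains; subtracting the projection picks a reduced representative of a relative class.
\<close>

lemma reduced_part:
  fixes c :: "'a list \<Rightarrow>\<^sub>0 int"
  assumes "t \<in> X" "c \<in> carrier (chains X n)"
  shows "induced (\<lambda>_. t) c \<in> carrier (chains {t} n)"
    and "c - induced (\<lambda>_. t) c \<in> reduced_chains X n"
proof -
  show const: "induced (\<lambda>_. t) c \<in> carrier (chains {t} n)"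
    using assms(2) by (rule induced_in_chains) auto
  have "induced (\<lambda>_. t) c \<in> carrier (chains X n)"
    using const chains_mono[of "{t}" X n] assms(1) by auto
  then show "c - induced (\<lambda>_. t) c \<in> reduced_chains X n"
    using assms(2) by (simp add: reduced_chains_iff[where t = t] diff_in_chains induced_induced comp_def)
qed

lemma reduced_constant_chain_eq_0:
  fixes c :: "'a list \<Rightarrow>\<^sub>0 int"
  assumes "c \<in> carrier (chains {t} n)" "induced (\<lambda>_. t) c = 0"
  shows "c = 0"
  using assms induced_ident[OF assms(1), of "\<lambda>_. t"] by simp

lemma (in spindle) boundary_const:
  assumes "c \<in> carrier (chains X n)" "t \<in> X"
  shows "boundary star a b d (induced (\<lambda>_. t) c) = induced (\<lambda>_. t) (boundary star a b d c)"
  using assms(1) by (rule induced_boundary) (simp add: star_idem assms(2))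

text \<open>
  The boundary of the representative is a chain on \<open>{t}\<close> and is also reduced, hence \<open>0\<close>: a relative
  cycle becomes an absolute one.
\<close>

lemma (in spindle) reduced_representative_of_rel_cycle:
  assumes t: "t \<in> X" and c: "c \<in> carrier (chains X n)"
    and cyc: "boundary star a b d c \<in> carrier (chains {t} (n - 1))"
  shows "c - induced (\<lambda>_. t) c \<in> reduced_cycles star a b d X n"
proof -
  have "boundary star a b d (c - induced (\<lambda>_. t) c) = 0"
  proof (rule reduced_constant_chain_eq_0)
    show "boundary star a b d (c - induced (\<lambda>_. t) c) \<in> carrier (chains {t} (n - 1))"
      using cyc spindle.boundary_in_chains[OF singleton_spindle[OF t] reduced_part(1)[OF t c]]
      by (simp add: diff_in_chains)
    show "induced (\<lambda>_. t) (boundary star a b d (c - induced (\<lambda>_. t) c)) = 0"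
      using boundary_const[OF c t, of a b d] by (simp add: induced_induced comp_def)
  qed
  then show ?thesis
    using reduced_part(2)[OF t c] by (simp add: reduced_cycles_def)
qed

text \<open>
  If \<open>c\<close> is the boundary of \<open>e\<close> up to a chain on \<open>{t}\<close>, then passing to the reduced part of \<open>e\<close>
  leaves an error that is both reduced and a chain on \<open>{t}\<close>, hence \<open>0\<close>.
\<close>

lemma (in spindle) reduced_rel_boundary_iff:
  assumes t: "t \<in> X" and c: "c \<in> reduced_cycles star a b d X n"
  shows "carrier (chains {t} n) #>\<^bsub>chains X n\<^esub> c \<in> rel_boundaries star a b d X t n
    \<longleftrightarrow> c \<in> reduced_boundaries star a b d X n"
proof -
  let ?D = "boundary star a b d" and ?N = "carrier (chains {t} n)"
  have cX: "c \<in> carrier (chains X n)" and c0: "induced (\<lambda>_. t) c = 0"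
    using c by (auto simp: reduced_cycles_def reduced_chains_def)
  have DX: "?D e \<in> carrier (chains X n)" if "e \<in> carrier (chains X (n + 1))" for e
    using boundary_in_chains[OF that, of a b d] by simp
  have "?N #>\<^bsub>chains X n\<^esub> c \<in> rel_boundaries star a b d X t n
      \<longleftrightarrow> (\<exists>e \<in> carrier (chains X (n + 1)). ?N #>\<^bsub>chains X n\<^esub> c = ?N #>\<^bsub>chains X n\<^esub> ?D e)"
    using rel_boundary_class[OF t, of _ "n + 1" a b d]
    by (auto simp: rel_boundaries_def carrier_rel_chains)
  also have "\<dots> \<longleftrightarrow> (\<exists>e \<in> carrier (chains X (n + 1)). c - ?D e \<in> ?N)"
    using rel_chain_class_eq_iff[OF t cX DX] by blast
  also have "\<dots> \<longleftrightarrow> (\<exists>e \<in> reduced_chains X (n + 1). c = ?D e)"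
  proof
    assume "\<exists>e \<in> carrier (chains X (n + 1)). c - ?D e \<in> ?N"
    then obtain e where e: "e \<in> carrier (chains X (n + 1))" and ce: "c - ?D e \<in> ?N"
      by blast
    let ?e = "e - induced (\<lambda>_. t) e"
    have "?D (induced (\<lambda>_. t) e) \<in> ?N"
      using spindle.boundary_in_chains[OF singleton_spindle[OF t] reduced_part(1)[OF t e]] by simp
    then have "c - ?D e + ?D (induced (\<lambda>_. t) e) \<in> ?N"
      using ce by (rule add_in_chains[rotated])
    then have "c - ?D ?e \<in> ?N"
      by (simp add: algebra_simps)
    moreover have "induced (\<lambda>_. t) (c - ?D ?e) = 0"
      using c0 boundary_const[OF e t, of a b d] by (simp add: induced_induced comp_def)
    ultimately have "c - ?D ?e = 0"
      by (rule reduced_constant_chain_eq_0)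
    then show "\<exists>e \<in> reduced_chains X (n + 1). c = ?D e"
      using reduced_part(2)[OF t e] by (intro bexI[of _ ?e]) auto
  qed (use zero_in_chains in \<open>force simp: reduced_chains_def\<close>)
  finally show ?thesis
    by (auto simp: reduced_boundaries_def)
qed

lemma (in spindle) subgroup_rel_cycles:
  assumes "t \<in> X"
  shows "subgroup (rel_cycles star a b d X t n) (rel_chains X t n)"
  unfolding rel_cycles_def by (rule group_hom.subgroup_kernel[OF rel_boundary_group_hom[OF assms]])

lemma (in spindle) rel_boundaries_subset_rel_cycles:
  assumes t: "t \<in> X"
  shows "rel_boundaries star a b d X t n \<subseteq> rel_cycles star a b d X t n"
proof -
  have "boundary star a b d e \<in> carrier (chains X n)" if "e \<in> carrier (chains X (n + 1))" for e
    using boundary_in_chains[OF that, of a b d] by simp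
  then show ?thesis
    using rel_boundary_class[OF t, of _ "n + 1" a b d]
    by (auto simp: rel_boundaries_def carrier_rel_chains
        rel_chain_class_in_rel_cycles_iff t boundary_boundary)
qed

lemma (in spindle) normal_rel_boundaries:
  assumes t: "t \<in> X"
  shows "rel_boundaries star a b d X t n
    \<lhd> (rel_chains X t n)\<lparr>carrier := rel_cycles star a b d X t n\<rparr>"
proof -
  interpret R: comm_group "rel_chains X t n"
    using t by (rule comm_group_rel_chains)
  have "subgroup (rel_boundaries star a b d X t n) (rel_chains X t n)"
    using group_hom.img_is_subgroup[OF rel_boundary_group_hom[OF t, of "n + 1" a b d]]
    by (simp add: rel_boundaries_def)
  then have "subgroup (rel_boundaries star a b d X t n)
      ((rel_chains X t n)\<lparr>carrier := rel_cycles star a b d X t n\<rparr>)"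
    by (rule R.subgroup_incl) (use t in \<open>auto intro: subgroup_rel_cycles
          rel_boundaries_subset_rel_cycles[THEN subsetD]\<close>)
  moreover have "comm_group ((rel_chains X t n)\<lparr>carrier := rel_cycles star a b d X t n\<rparr>)"
    using R.subgroup_imp_group[OF subgroup_rel_cycles[OF t]]
    by (rule group.group_comm_groupI)
      (simp add: R.m_comm subgroup.mem_carrier[OF subgroup_rel_cycles[OF t]])
  ultimately show ?thesis
    by (simp add: comm_group.normal_iff_subgroup)
qed

text \<open>
  Sending a reduced cycle to its relative homology class is onto, since relative cycles have reduced
  representatives, and its kernel consists of the reduced boundaries. In particular \<open>H\<^sub>n(X,t)\<close> does
  not depend on \<open>t\<close>, up to isomorphism.
\<close>

lemma (in spindle) reduced_boundaries_quotient:
  assumes t: "t \<in> X"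
  shows "reduced_boundaries star a b d X n \<lhd> reduced_cycle_group star a b d X n"
    and "reduced_cycle_group star a b d X n Mod reduced_boundaries star a b d X n
      \<cong> rel_homology star a b d X t n"
proof -
  let ?Z = "reduced_cycle_group star a b d X n" and ?B = "reduced_boundaries star a b d X n"
  let ?N = "carrier (chains {t} n)"
  let ?cl = "\<lambda>c. ?N #>\<^bsub>chains X n\<^esub> c"
  define P where "P = (rel_chains X t n)\<lparr>carrier := rel_cycles star a b d X t n\<rparr>"
  define Q where "Q = rel_boundaries star a b d X t n"
  define H where "H = rel_homology star a b d X t n"
  define \<phi> where "\<phi> = (\<lambda>c. Q #>\<^bsub>P\<^esub> ?cl c)"
  have H: "H = P Mod Q"
    by (simp add: H_def rel_homology_def P_def Q_def)
  have Q: "Q \<lhd> P"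
    unfolding P_def Q_def using t by (rule normal_rel_boundaries)
  interpret Q: normal Q P by (rule Q)
  have Z: "c \<in> carrier (chains X n)" "boundary star a b d c = 0"
    if "c \<in> reduced_cycles star a b d X n" for c
    using that by (auto simp: reduced_cycles_def reduced_chains_def)
  have cl: "?cl c \<in> carrier P" if "c \<in> reduced_cycles star a b d X n" for c
    using Z[OF that] by (simp add: P_def rel_chain_class_in_rel_cycles_iff t)
  have "?cl \<in> hom ?Z P"
  proof (rule homI)
    show "?cl (c \<otimes>\<^bsub>?Z\<^esub> e) = ?cl c \<otimes>\<^bsub>P\<^esub> ?cl e"
      if "c \<in> carrier ?Z" "e \<in> carrier ?Z" for c e
      using that rel_chain_class_mult[OF t Z(1) Z(1), of c e] by (simp add: P_def)
  qed (simp add: cl)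
  then have "\<phi> \<in> hom ?Z H"
    unfolding \<phi>_def H using hom_compose[OF _ Q.r_coset_hom_Mod] by (simp add: comp_def)
  then interpret \<phi>: group_hom ?Z H \<phi>
    using comm_group.axioms(2)[OF comm_group_reduced_cycle_group] Q.factorgroup_is_group
    by (simp add: group_hom_def group_hom_axioms_def H)
  have "kernel ?Z H \<phi> = {c \<in> reduced_cycles star a b d X n. ?cl c \<in> Q}"
    using Q.coset_join1[OF _ cl Q.subgroup_axioms] Q.coset_join2[OF cl Q.subgroup_axioms]
    by (auto simp: kernel_def H \<phi>_def)
  also have "\<dots> = {c \<in> reduced_cycles star a b d X n. c \<in> ?B}"
    using reduced_rel_boundary_iff[OF t] unfolding Q_def by blast
  also have "\<dots> = ?B"
  proof -
    have "boundary star a b d e \<in> reduced_cycles star a b d X n" if "e \<in> reduced_chains X (n + 1)" for e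
      using that boundary_in_chains[of e "n + 1" a b d] boundary_boundary[of e "n + 1" a b d]
        boundary_const[of e "n + 1" t a b d] t
      by (auto simp: reduced_cycles_def reduced_chains_iff[where t = t])
    then show ?thesis by (auto simp: reduced_boundaries_def)
  qed
  finally have ker: "kernel ?Z H \<phi> = ?B" .
  show "?B \<lhd> ?Z"
    using \<phi>.normal_kernel unfolding ker .
  have "\<phi> ` carrier ?Z = carrier H"
  proof
    show "carrier H \<subseteq> \<phi> ` carrier ?Z"
    proof
      fix h assume "h \<in> carrier H"
      then obtain k where k: "k \<in> carrier P" and h: "h = Q #>\<^bsub>P\<^esub> k"
        by (auto simp: H carrier_FactGroup)
      have "k \<in> carrier (rel_chains X t n)"
        using k by (simp add: P_def rel_cycles_def kernel_def)
      then obtain c where c: "c \<in> carrier (chains X n)" and kc: "k = ?cl c"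
        by (auto simp: carrier_rel_chains)
      have red: "c - induced (\<lambda>_. t) c \<in> reduced_cycles star a b d X n"
        using t c by (rule reduced_representative_of_rel_cycle)
          (use k t c in \<open>simp add: kc P_def rel_chain_class_in_rel_cycles_iff\<close>)
      have "?cl c = ?cl (c - induced (\<lambda>_. t) c)"
        using rel_chain_class_eq_iff[OF t c Z(1)[OF red]] reduced_part(1)[OF t c] by simp
      with red show "h \<in> \<phi> ` carrier ?Z"
        by (auto simp: h kc \<phi>_def)
    qed
  qed auto
  from \<phi>.FactGroup_iso[OF this] show "?Z Mod ?B \<cong> rel_homology star a b d X t n"
    unfolding ker unfolding H_def .
qed

section \<open>Right orbits\<close>

lemma (in spindle) right_orbit_spindle:
  assumes x: "x \<in> X"
  shows "spindle (right_orbit X star x) star"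
proof
  have sub: "right_orbit X star x \<subseteq> X"
    using x star_closed by (auto simp: right_orbit_def)
  show "star p q \<in> right_orbit X star x" if pq: "p \<in> right_orbit X star x" "q \<in> right_orbit X star x" for p q
  proof -
    obtain y z where yz: "y \<in> X" "z \<in> X" and "p = star y x" "q = star z x"
      using pq by (auto simp: right_orbit_def)
    then have "star p q = star (star y z) x"
      using x star_distrib by simp
    then show ?thesis
      using star_closed[OF yz] by (auto simp: right_orbit_def)
  qed
  show "star (star p q) r = star (star p r) (star q r)"
    if "p \<in> right_orbit X star x" "q \<in> right_orbit X star x" "r \<in> right_orbit X star x" for p q r
    using that sub by (intro star_distrib) auto
  show "star p p = p" if "p \<in> right_orbit X star x" for p
    using that sub by (intro star_idem) auto
qed

lemma (in spindle) right_unit_right_orbit: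
  assumes "right_unit X star u" "x \<in> X"
  shows "right_unit (right_orbit X star x) star (star u x)"
  unfolding right_unit_def
proof (intro conjI ballI)
  show "star u x \<in> right_orbit X star x"
    using assms(1) by (auto simp: right_unit_def right_orbit_def)
  fix p assume "p \<in> right_orbit X star x"
  then obtain y where y: "y \<in> X" "p = star y x" by (auto simp: right_orbit_def)
  then show "star p (star u x) = p"
    using star_distrib[of y u x] assms by (simp add: right_unit_def)
qed

text \<open>
  The translation from \<open>X\<close> to \<open>Y\<close> induces the isomorphism. If the translate of a cycle \<open>c\<close> bounds
  in \<open>Y\<close>, it bounds in \<open>X\<close>, and so does \<open>c\<close>, which is homologous to it in \<open>X\<close>. A cycle of \<open>Y\<close> is
  also a cycle of \<open>X\<close>, and it is homologous in \<open>Y\<close> to its own translate, which gives surjectivity.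
\<close>

lemma (in spindle) reduced_homology_right_orbit:
  fixes u :: 'a
  assumes unit: "right_unit X star u" and coprime: "gcd a b = 1" and x: "x \<in> X"
  defines "Y \<equiv> right_orbit X star x"
  shows "reduced_cycle_group star a b d X n Mod reduced_boundaries star a b d X n
    \<cong> reduced_cycle_group star a b d Y n Mod reduced_boundaries star a b d Y n"
proof -
  let ?ZX = "reduced_cycle_group star a b d X n" and ?BX = "reduced_boundaries star a b d X n"
  let ?ZY = "reduced_cycle_group star a b d Y n" and ?BY = "reduced_boundaries star a b d Y n"
  let ?r = "induced (\<lambda>y. star y x)"
  have YX: "Y \<subseteq> X"
    using x star_closed by (auto simp: Y_def right_orbit_def)
  have img: "(\<lambda>y. star y x) ` X \<subseteq> Y"
    by (auto simp: Y_def right_orbit_def)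
  \<comment> \<open>Idempotence puts \<open>x\<close> into its own right orbit, so that the homotopy is available in \<open>Y\<close>.\<close>
  have xY: "x \<in> Y"
    using x star_idem[OF x] unfolding Y_def right_orbit_def by force
  interpret Y: spindle Y star
    unfolding Y_def using x by (rule right_orbit_spindle)
  have unitY: "right_unit Y star (star u x)"
    unfolding Y_def using unit x by (rule right_unit_right_orbit)
  interpret BY: normal ?BY ?ZY
    using xY by (rule Y.reduced_boundaries_quotient(1))
  define \<psi> where "\<psi> = (\<lambda>c. ?BY #>\<^bsub>?ZY\<^esub> ?r c)"
  have rZ: "?r c \<in> carrier ?ZY" if "c \<in> carrier ?ZX" for c
    using that induced_translation_reduced_cycles[OF _ x img] by simp
  have "?r \<in> hom ?ZX ?ZY"
    by (rule homI) (use rZ in auto)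
  then have "\<psi> \<in> hom ?ZX (?ZY Mod ?BY)"
    unfolding \<psi>_def using hom_compose[OF _ BY.r_coset_hom_Mod] by (simp add: comp_def)
  then interpret \<psi>: group_hom ?ZX "?ZY Mod ?BY" \<psi>
    using comm_group.axioms(2)[OF comm_group_reduced_cycle_group] BY.factorgroup_is_group
    by (simp add: group_hom_def group_hom_axioms_def)
  have ZYX: "carrier ?ZY \<subseteq> carrier ?ZX"
    using chains_mono[OF YX, of n] by (auto simp: reduced_cycles_def reduced_chains_def)
  have BZ: "?BX \<subseteq> carrier ?ZX"
    using reduced_boundaries_quotient(1)[OF x] normal_imp_subgroup subgroup.subset by blast
  have "?r c \<in> ?BY \<longleftrightarrow> c \<in> ?BX" if c: "c \<in> carrier ?ZX" for c
  proof
    assume "?r c \<in> ?BY"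
    then have "?r c \<in> ?BX"
      using reduced_boundaries_mono[OF YX] by blast
    moreover have "?r c - c \<in> ?BX"
      using unit coprime x c by (intro translation_homologous_identity) auto
    ultimately have "?r c - (?r c - c) \<in> ?BX"
      by (rule reduced_boundaries_diff)
    then show "c \<in> ?BX" by simp
  next
    assume "c \<in> ?BX"
    then obtain e where e: "e \<in> reduced_chains X (n + 1)" and ce: "c = boundary star a b d e"
      by (auto simp: reduced_boundaries_def)
    have "boundary star a b d (?r e) = ?r c"
      unfolding ce using e x
      by (intro induced_boundary[of e X "n + 1"]) (auto simp: reduced_chains_def star_distrib)
    then show "?r c \<in> ?BY"
      using induced_reduced_chains[OF e img] unfolding reduced_boundaries_def by force
  qed
  moreover have "\<psi> c = ?BY \<longleftrightarrow> ?r c \<in> ?BY" if "c \<in> carrier ?ZX" for c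
    using BY.coset_join1[OF _ rZ[OF that] BY.subgroup_axioms]
      BY.coset_join2[OF rZ[OF that] BY.subgroup_axioms] by (auto simp: \<psi>_def)
  ultimately have "kernel ?ZX (?ZY Mod ?BY) \<psi> = ?BX"
    using BZ by (auto simp: kernel_def)
  moreover have "\<psi> ` carrier ?ZX = carrier (?ZY Mod ?BY)"
  proof
    show "carrier (?ZY Mod ?BY) \<subseteq> \<psi> ` carrier ?ZX"
    proof
      fix h assume "h \<in> carrier (?ZY Mod ?BY)"
      then obtain c where c: "c \<in> carrier ?ZY" and h: "h = ?BY #>\<^bsub>?ZY\<^esub> c"
        by (auto simp: carrier_FactGroup)
      have cX: "c \<in> carrier ?ZX" using c ZYX by blast
      have hom: "?r c - c \<in> ?BY"
        using unitY coprime xY c by (intro Y.translation_homologous_identity) auto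
      have "?r c = (?r c - c) \<otimes>\<^bsub>?ZY\<^esub> c" by simp
      then have "?r c \<in> ?BY #>\<^bsub>?ZY\<^esub> c"
        using hom unfolding r_coset_def by blast
      then have "\<psi> c = h"
        unfolding h \<psi>_def using c BY.repr_independence[OF _ _ BY.subgroup_axioms] by auto
      then show "h \<in> \<psi> ` carrier ?ZX" using cX by blast
    qed
  qed auto
  ultimately show ?thesis
    using \<psi>.FactGroup_iso by simp
qed

theorem theorem6p5:
  fixes X :: "'a set" and star :: "'a \<Rightarrow> 'a \<Rightarrow> 'a" and a b d n :: int and x t :: 'a
  assumes "spindle X star"
    and "\<exists>u. right_unit X star u"
    and "gcd a b = 1"
    and "x \<in> X" and "t \<in> X"
  shows "rel_homology star a b d X t n
       \<cong> rel_homology star a b d (right_orbit X star x) (star t x) n"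
proof -
  interpret X: spindle X star by fact
  obtain u where u: "right_unit X star u"
    using assms(2) by blast
  let ?Y = "right_orbit X star x"
  let ?redX = "reduced_cycle_group star a b d X n Mod reduced_boundaries star a b d X n"
  let ?redY = "reduced_cycle_group star a b d ?Y n Mod reduced_boundaries star a b d ?Y n"
  interpret Y: spindle ?Y star
    using assms(4) by (rule X.right_orbit_spindle)
  have tY: "star t x \<in> ?Y"
    using assms(5) by (auto simp: right_orbit_def)
  have "group ?redX"
    using X.reduced_boundaries_quotient(1)[OF assms(5)] by (rule normal.factorgroup_is_group)
  then have "rel_homology star a b d X t n \<cong> ?redX"
    using X.reduced_boundaries_quotient(2)[OF assms(5)] by (rule group.iso_sym)
  also have "?redX \<cong> ?redY"
    using u assms(3,4) by (rule X.reduced_homology_right_orbit)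
  also have "?redY \<cong> rel_homology star a b d ?Y (star t x) n"
    using tY by (rule Y.reduced_boundaries_quotient(2))
  finally show ?thesis .
qed

end
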